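(* Let $(\mathcal A_1,\varphi_1)$, $(\mathcal A_2,\varphi_2)$ be noncommutative probability spaces, $a_1\in\mathcal A_1$, $a_2\in\mathcal A_2$, and let $$Z=R_2R_1,\qquad R_1=a_1\otimes P_2+1_1\otimes P_2^\perp,\qquad R_2=P_1^\perp\otimes a_2+P_1\otimes 1_2,$$ considered with the functional $\varphi=\varphi_1\otimes\varphi_2$ as in the context. If the $\varphi_2$-distribution of $a_2$ is not concentrated at zero (i.e. is not $\delta_0$), then the formal power series corresponding to $a_1$, $a_2$ and $Z$ satisfy $$\eta_Z(z)=\frac{z\,\eta_{a_1}(\eta_{a_2}(z))}{\eta_{a_2}(z)}.$$ If the distribution of $a_2$ is concentrated at zero, then $\eta_Z(z)=z\mu_1(X)$, where $\mu_1$ is the $\varphi_1$-distribution of $a_1$ (so $\mu_1(X)=\varphi_1(a_1)$).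
   Context: A noncommutative probability space $(\mathcal A,\varphi)$ is a unital complex algebra with a linear functional with $\varphi(1)=1$. Each $(\mathcal A_\iota,\varphi_\iota)$ is extended to the free product with identified units $\mathcal A_\iota*\mathbb C[P_\iota]$, $P_\iota^2=P_\iota$, with the functional (again denoted $\varphi_\iota$) extending $\varphi_\iota$ and determined by $\varphi_\iota(P_\iota)=1$, $\varphi_\iota(w_1P_\iota w_2)=\varphi_\iota(w_1)\varphi_\iota(w_2)$; $P_\iota^\perp=1_\iota-P_\iota$. (When $\mathcal A_\iota=B(\mathcal H_\iota)$ with vector state of $\xi_\iota$, $P_\iota$ is the projection onto $\mathbb C\xi_\iota$.) The operators $R_1,R_2,Z$ lie in the tensor product of the two extended algebras with $\varphi=\varphi_1\otimes\varphi_2$. The distribution of $a$ is the functional $\mu(X^n)=\varphi(a^n)$ on $\mathbb C[X]$; $\delta_0$ is the distribution whose moments of order $n\geq1$ vanish. For a random variable $a$, $\psi_a(z)=\sum_{n\ge1}\varphi(a^n)z^n$ and $\eta_a(z)=\psi_a(z)/(1+\psi_a(z))$, as formal power series; $\eta_{a_\iota}$ refers to $\varphi_\iota$, $\eta_Z$ to $\varphi$. *)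

theory Defs
  imports Complex_Main "HOL-Computational_Algebra.Computational_Algebra"
begin

class complex_vector = ab_group_add +
  fixes scaleC :: "complex \<Rightarrow> 'a \<Rightarrow> 'a"  (infixr "*\<^sub>C" 75)
  assumes scaleC_add_right: "c *\<^sub>C (x + y) = c *\<^sub>C x + c *\<^sub>C y"
    and scaleC_add_left: "(c + d) *\<^sub>C x = c *\<^sub>C x + d *\<^sub>C x"
    and scaleC_scaleC: "c *\<^sub>C d *\<^sub>C x = (c * d) *\<^sub>C x"
    and scaleC_one: "1 *\<^sub>C x = x"

global_interpretation cvec: vector_space "scaleC :: complex \<Rightarrow> 'a \<Rightarrow> 'a::complex_vector"
  by standard (simp_all add: scaleC_add_right scaleC_add_left scaleC_scaleC scaleC_one)

text \<open>
  Unital associative complex algebras. The inequality 0 \<open>\<noteq>\<close> 1 is not an axiom; it follows from the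
  existence of a linear functional with value 1 at the unit.
\<close>
class complex_algebra_1 = complex_vector + ring + monoid_mult +
  assumes mult_scaleC_left: "(c *\<^sub>C x) * y = c *\<^sub>C (x * y)"
    and mult_scaleC_right: "x * (c *\<^sub>C y) = c *\<^sub>C (x * y)"

instantiation complex :: complex_algebra_1
begin
definition scaleC_complex :: "complex \<Rightarrow> complex \<Rightarrow> complex"
  where "scaleC_complex c x = c * x"
instance
  by standard (simp_all add: scaleC_complex_def algebra_simps)
end

abbreviation clinear :: "('a::complex_vector \<Rightarrow> 'b::complex_vector) \<Rightarrow> bool"
  where "clinear \<equiv> Vector_Spaces.linear scaleC scaleC"

lemma clinearI:
  assumes "\<And>x y. f (x + y) = f x + f y" "\<And>c x. f (c *\<^sub>C x) = c *\<^sub>C f x"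
  shows "clinear f"
  using assms
  by (auto simp: Vector_Spaces.linear_def module_hom_def module_hom_axioms_def
      cvec.vector_space_axioms cvec.module_axioms)

lemma clinear_add: "clinear f \<Longrightarrow> f (x + y) = f x + f y"
  and clinear_scaleC: "clinear f \<Longrightarrow> f (c *\<^sub>C x) = c *\<^sub>C f x"
  by (auto simp: Vector_Spaces.linear_def module_hom_def module_hom_axioms_def)

lemma clinear_diff: "clinear f \<Longrightarrow> f (x - y) = f x - f y"
  using clinear_add[of f "x - y" y] by (simp add: algebra_simps)

lemma clinear_0: "clinear f \<Longrightarrow> f 0 = 0"
  using clinear_diff[of f 0 0] by simp

definition algebra_hom :: "('a::complex_algebra_1 \<Rightarrow> 'b::complex_algebra_1) \<Rightarrow> bool"
  where "algebra_hom f \<longleftrightarrow> clinear f \<and> f 1 = 1 \<and> (\<forall>x y. f (x * y) = f x * f y)"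

definition nc_prob_space :: "('a::complex_algebra_1 \<Rightarrow> complex) \<Rightarrow> bool"
  where "nc_prob_space \<phi> \<longleftrightarrow> clinear \<phi> \<and> \<phi> 1 = 1"

text \<open>
  Formal algebra expressions over the disjoint union of the two algebras, modulo the least
  congruence that enforces the laws of a unital algebra, makes both inclusions linear and
  multiplicative, and identifies the units.
\<close>
datatype ('a, 'b) fp_term =
    FInl 'a
  | FInr 'b
  | FAdd "('a, 'b) fp_term" "('a, 'b) fp_term"
  | FMul "('a, 'b) fp_term" "('a, 'b) fp_term"
  | FScale complex "('a, 'b) fp_term"

inductive fp_eq ::
    "('a::complex_algebra_1, 'b::complex_algebra_1) fp_term \<Rightarrow> ('a, 'b) fp_term \<Rightarrow> bool"
where
  fp_refl: "fp_eq x x"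
| fp_sym: "fp_eq x y \<Longrightarrow> fp_eq y x"
| fp_trans: "fp_eq x y \<Longrightarrow> fp_eq y z \<Longrightarrow> fp_eq x z"
| fp_cong_add: "fp_eq x x' \<Longrightarrow> fp_eq y y' \<Longrightarrow> fp_eq (FAdd x y) (FAdd x' y')"
| fp_cong_mul: "fp_eq x x' \<Longrightarrow> fp_eq y y' \<Longrightarrow> fp_eq (FMul x y) (FMul x' y')"
| fp_cong_scale: "fp_eq x x' \<Longrightarrow> fp_eq (FScale c x) (FScale c x')"
| fp_add_assoc: "fp_eq (FAdd (FAdd x y) z) (FAdd x (FAdd y z))"
| fp_add_comm: "fp_eq (FAdd x y) (FAdd y x)"
| fp_add_zero: "fp_eq (FAdd (FInl 0) x) x"
| fp_add_neg: "fp_eq (FAdd (FScale (-1) x) x) (FInl 0)"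
| fp_scale_add_right: "fp_eq (FScale c (FAdd x y)) (FAdd (FScale c x) (FScale c y))"
| fp_scale_add_left: "fp_eq (FScale (c + d) x) (FAdd (FScale c x) (FScale d x))"
| fp_scale_scale: "fp_eq (FScale c (FScale d x)) (FScale (c * d) x)"
| fp_scale_one: "fp_eq (FScale 1 x) x"
| fp_mul_assoc: "fp_eq (FMul (FMul x y) z) (FMul x (FMul y z))"
| fp_mul_one_left: "fp_eq (FMul (FInl 1) x) x"
| fp_mul_one_right: "fp_eq (FMul x (FInl 1)) x"
| fp_distrib_right: "fp_eq (FMul (FAdd x y) z) (FAdd (FMul x z) (FMul y z))"
| fp_distrib_left: "fp_eq (FMul x (FAdd y z)) (FAdd (FMul x y) (FMul x z))"
| fp_mul_scale_left: "fp_eq (FMul (FScale c x) y) (FScale c (FMul x y))"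
| fp_mul_scale_right: "fp_eq (FMul x (FScale c y)) (FScale c (FMul x y))"
| fp_inl_add: "fp_eq (FInl (a + a')) (FAdd (FInl a) (FInl a'))"
| fp_inl_mul: "fp_eq (FInl (a * a')) (FMul (FInl a) (FInl a'))"
| fp_inl_scale: "fp_eq (FInl (c *\<^sub>C a)) (FScale c (FInl a))"
| fp_inr_add: "fp_eq (FInr (b + b')) (FAdd (FInr b) (FInr b'))"
| fp_inr_mul: "fp_eq (FInr (b * b')) (FMul (FInr b) (FInr b'))"
| fp_inr_scale: "fp_eq (FInr (c *\<^sub>C b)) (FScale c (FInr b))"
| fp_units: "fp_eq (FInr 1) (FInl 1)"

lemmas fp_laws =
  fp_add_assoc fp_add_comm fp_add_zero fp_add_neg fp_scale_add_right
  fp_scale_add_left fp_scale_scale fp_scale_one fp_mul_assoc fp_mul_one_left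
  fp_mul_one_right fp_distrib_right fp_distrib_left fp_mul_scale_left fp_mul_scale_right
  fp_inl_add fp_inl_mul fp_inl_scale fp_inr_add fp_inr_mul
  fp_inr_scale fp_units

quotient_type (overloaded) ('a, 'b) free_product =
    "('a::complex_algebra_1, 'b::complex_algebra_1) fp_term" / fp_eq
  by (intro equivpI reflpI sympI transpI) (blast intro: fp_refl fp_sym fp_trans)+

instantiation free_product :: (complex_algebra_1, complex_algebra_1) complex_algebra_1
begin

lift_definition zero_free_product :: "('a, 'b) free_product" is "FInl 0" .
lift_definition one_free_product :: "('a, 'b) free_product" is "FInl 1" .
lift_definition plus_free_product ::
    "('a, 'b) free_product \<Rightarrow> ('a, 'b) free_product \<Rightarrow> ('a, 'b) free_product"
  is FAdd by (rule fp_cong_add)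
lift_definition times_free_product ::
    "('a, 'b) free_product \<Rightarrow> ('a, 'b) free_product \<Rightarrow> ('a, 'b) free_product"
  is FMul by (rule fp_cong_mul)
lift_definition scaleC_free_product ::
    "complex \<Rightarrow> ('a, 'b) free_product \<Rightarrow> ('a, 'b) free_product"
  is FScale by (rule fp_cong_scale)
definition uminus_free_product :: "('a, 'b) free_product \<Rightarrow> ('a, 'b) free_product"
  where "uminus_free_product x = (-1) *\<^sub>C x"
definition minus_free_product ::
    "('a, 'b) free_product \<Rightarrow> ('a, 'b) free_product \<Rightarrow> ('a, 'b) free_product"
  where "minus_free_product x y = x + - y"

instance
proof
  fix x y z :: "('a, 'b) free_product" and c d :: complex
  show "x + y + z = x + (y + z)" "x + y = y + x" "0 + x = x"
    "c *\<^sub>C (x + y) = c *\<^sub>C x + c *\<^sub>C y" "(c + d) *\<^sub>C x = c *\<^sub>C x + d *\<^sub>C x"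
    "c *\<^sub>C d *\<^sub>C x = (c * d) *\<^sub>C x" "1 *\<^sub>C x = x"
    "x * y * z = x * (y * z)" "1 * x = x" "x * 1 = x"
    "(x + y) * z = x * z + y * z" "x * (y + z) = x * y + x * z"
    "c *\<^sub>C x * y = c *\<^sub>C (x * y)" "x * c *\<^sub>C y = c *\<^sub>C (x * y)"
    by (transfer, rule fp_laws)+
  show "- x + x = 0"
    unfolding uminus_free_product_def by (transfer, rule fp_add_neg)
  show "x - y = x + - y" by (rule minus_free_product_def)
qed

end

lift_definition inl :: "'a \<Rightarrow> ('a::complex_algebra_1, 'b::complex_algebra_1) free_product"
  is FInl .
lift_definition inr :: "'b \<Rightarrow> ('a::complex_algebra_1, 'b::complex_algebra_1) free_product"
  is FInr .

lemma inl_add: "inl (a + a') = inl a + inl a'"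
  and inl_mult: "inl (a * a') = inl a * inl a'"
  and inl_scaleC: "inl (c *\<^sub>C a) = c *\<^sub>C inl a"
  and inr_add: "inr (b + b') = inr b + inr b'"
  and inr_mult: "inr (b * b') = inr b * inr b'"
  and inr_scaleC: "inr (c *\<^sub>C b) = c *\<^sub>C inr b"
  and inl_one: "inl 1 = 1"
  and inr_one: "inr 1 = 1"
  by (simp_all only: inl.abs_eq inr.abs_eq plus_free_product.abs_eq times_free_product.abs_eq
      scaleC_free_product.abs_eq one_free_product.abs_eq free_product.abs_eq_iff fp_laws fp_refl)

lemma algebra_hom_inl: "algebra_hom inl"
  unfolding algebra_hom_def by (simp add: clinearI inl_add inl_mult inl_scaleC inl_one)

lemma algebra_hom_inr: "algebra_hom inr"
  unfolding algebra_hom_def by (simp add: clinearI inr_add inr_mult inr_scaleC inr_one)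

lemma free_product_induct [case_names inl inr add mult scaleC]:
  assumes "\<And>a. P (inl a)" "\<And>b. P (inr b)"
    and "\<And>x y. P x \<Longrightarrow> P y \<Longrightarrow> P (x + y)" "\<And>x y. P x \<Longrightarrow> P y \<Longrightarrow> P (x * y)"
    and "\<And>c x. P x \<Longrightarrow> P (c *\<^sub>C x)"
  shows "P x"
proof -
  have "P (abs_free_product t)" for t
  proof (induction t)
    case (FInl a) then show ?case using assms(1)[of a] by (simp add: inl.abs_eq)
  next
    case (FInr b) then show ?case using assms(2)[of b] by (simp add: inr.abs_eq)
  next
    case (FAdd s t) then show ?case using assms(3) by (simp add: plus_free_product.abs_eq[symmetric])
  next
    case (FMul s t) then show ?case using assms(4) by (simp add: times_free_product.abs_eq[symmetric])
  next
    case (FScale c t) then show ?case using assms(5) by (simp add: scaleC_free_product.abs_eq[symmetric])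
  qed
  then show ?thesis by (metis Quotient_abs_rep[OF Quotient_free_product])
qed

primrec fp_eval :: "('a \<Rightarrow> 'c) \<Rightarrow> ('b \<Rightarrow> 'c) \<Rightarrow> ('a, 'b) fp_term \<Rightarrow> 'c::complex_algebra_1" where
  "fp_eval f g (FInl a) = f a"
| "fp_eval f g (FInr b) = g b"
| "fp_eval f g (FAdd s t) = fp_eval f g s + fp_eval f g t"
| "fp_eval f g (FMul s t) = fp_eval f g s * fp_eval f g t"
| "fp_eval f g (FScale c t) = c *\<^sub>C fp_eval f g t"

theorem free_product_universal:
  fixes f :: "'a::complex_algebra_1 \<Rightarrow> 'c::complex_algebra_1"
    and g :: "'b::complex_algebra_1 \<Rightarrow> 'c"
  assumes f: "algebra_hom f" and g: "algebra_hom g"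
  shows "\<exists>!h. algebra_hom h \<and> (\<forall>a. h (inl a) = f a) \<and> (\<forall>b. h (inr b) = g b)"
proof (rule ex_ex1I)
  have resp: "fp_eq s t \<Longrightarrow> fp_eval f g s = fp_eval f g t" for s t
    by (induction rule: fp_eq.induct)
      (use f g in \<open>simp_all add: algebra_hom_def algebra_simps clinear_add clinear_scaleC clinear_0
        scaleC_add_right scaleC_add_left scaleC_scaleC scaleC_one mult_scaleC_left
        mult_scaleC_right\<close>)
  define h where "h x = fp_eval f g (rep_free_product x)" for x
  have h: "h (abs_free_product t) = fp_eval f g t" for t
    unfolding h_def by (rule resp) (rule rep_abs_rsp_left[OF Quotient3_free_product fp_refl])
  have ex: "\<exists>t. x = abs_free_product t" for x :: "('a, 'b) free_product"
    by (metis Quotient_abs_rep[OF Quotient_free_product])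
  have hadd: "h (x + y) = h x + h y" and hmul: "h (x * y) = h x * h y"
    and hsc: "h (c *\<^sub>C x) = c *\<^sub>C h x" for x y c
    using ex[of x] ex[of y]
    by (auto simp: h plus_free_product.abs_eq times_free_product.abs_eq scaleC_free_product.abs_eq)
  show "\<exists>h. algebra_hom h \<and> (\<forall>a. h (inl a) = f a) \<and> (\<forall>b. h (inr b) = g b)"
    using f by (intro exI[of _ h])
      (auto simp: algebra_hom_def hadd hmul hsc h inl.abs_eq inr.abs_eq one_free_product.abs_eq
        intro!: clinearI)
next
  fix h h' :: "('a, 'b) free_product \<Rightarrow> 'c"
  assume h: "algebra_hom h \<and> (\<forall>a. h (inl a) = f a) \<and> (\<forall>b. h (inr b) = g b)"
    and h': "algebra_hom h' \<and> (\<forall>a. h' (inl a) = f a) \<and> (\<forall>b. h' (inr b) = g b)"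
  have "h x = h' x" for x
    by (induction x rule: free_product_induct)
      (use h h' in \<open>auto simp: algebra_hom_def clinear_add clinear_scaleC\<close>)
  then show "h = h'" ..
qed

text \<open>
  \<open>IP x y\<close> stands for \<open>x 1 + y P\<close> in the algebra \<open>\<complex>[P]\<close>, \<open>P\<^sup>2 = P\<close>, which has the basis \<open>1, P\<close>.
\<close>
datatype idem_alg = IP (coef1: complex) (coefP: complex)

instantiation idem_alg :: complex_algebra_1
begin
definition "0 = IP 0 0"
definition "1 = IP 1 0"
definition "u + v = IP (coef1 u + coef1 v) (coefP u + coefP v)"
definition "u - v = IP (coef1 u - coef1 v) (coefP u - coefP v)"
definition "- u = IP (- coef1 u) (- coefP u)"
definition "c *\<^sub>C u = IP (c * coef1 u) (c * coefP u)"
definition "u * v =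
  IP (coef1 u * coef1 v) (coef1 u * coefP v + coefP u * coef1 v + coefP u * coefP v)"
instance
  by standard (simp_all add: zero_idem_alg_def one_idem_alg_def plus_idem_alg_def
      minus_idem_alg_def uminus_idem_alg_def scaleC_idem_alg_def times_idem_alg_def
      algebra_simps idem_alg.expand)
end

type_synonym 'a ext = "('a, idem_alg) free_product"

definition projP :: "'a::complex_algebra_1 ext"
  where "projP = inr (IP 0 1)"

definition projP_perp :: "'a::complex_algebra_1 ext"
  where "projP_perp = 1 - projP"

lemma projP_idem: "projP * projP = projP"
  unfolding projP_def inr_mult[symmetric] by (simp add: times_idem_alg_def)

lemma inr_IP: "inr (IP x y) = x *\<^sub>C 1 + y *\<^sub>C projP"
proof -
  have "IP x y = x *\<^sub>C 1 + y *\<^sub>C IP 0 1"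
    by (simp add: scaleC_idem_alg_def one_idem_alg_def plus_idem_alg_def)
  then show ?thesis unfolding projP_def by (metis inr_add inr_scaleC inr_one)
qed

definition is_ext_functional ::
    "('a::complex_algebra_1 \<Rightarrow> complex) \<Rightarrow> ('a ext \<Rightarrow> complex) \<Rightarrow> bool"
  where "is_ext_functional \<phi> \<Phi> \<longleftrightarrow>
    clinear \<Phi> \<and> (\<forall>a. \<Phi> (inl a) = \<phi> a) \<and> \<Phi> projP = 1 \<and>
    (\<forall>w1 w2. \<Phi> (w1 * projP * w2) = \<Phi> w1 * \<Phi> w2)"

text \<open>Existence and uniqueness are proved below for every noncommutative probability space.\<close>
definition ext_functional :: "('a::complex_algebra_1 \<Rightarrow> complex) \<Rightarrow> 'a ext \<Rightarrow> complex"
  where "ext_functional \<phi> = (THE \<Phi>. is_ext_functional \<phi> \<Phi>)"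

text \<open>
  For existence, let the extended algebra act on the original one, \<open>P\<close> acting as the rank-one
  projection \<open>v \<mapsto> \<phi>(v) 1\<close>.
\<close>
primrec fp_act ::
    "('a::complex_algebra_1 \<Rightarrow> complex) \<Rightarrow> ('a, idem_alg) fp_term \<Rightarrow> 'a \<Rightarrow> 'a" where
  "fp_act \<phi> (FInl a) v = a * v"
| "fp_act \<phi> (FInr b) v = coef1 b *\<^sub>C v + (coefP b * \<phi> v) *\<^sub>C 1"
| "fp_act \<phi> (FAdd s t) v = fp_act \<phi> s v + fp_act \<phi> t v"
| "fp_act \<phi> (FMul s t) v = fp_act \<phi> s (fp_act \<phi> t v)"
| "fp_act \<phi> (FScale c t) v = c *\<^sub>C fp_act \<phi> t v"

lemma fp_act_linear:
  assumes "clinear \<phi>"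
  shows "fp_act \<phi> t (u + v) = fp_act \<phi> t u + fp_act \<phi> t v"
    and "fp_act \<phi> t (c *\<^sub>C v) = c *\<^sub>C fp_act \<phi> t v"
  by (induction t arbitrary: u v c)
    (simp_all add: clinear_add[OF assms] clinear_scaleC[OF assms] algebra_simps scaleC_add_right
      scaleC_add_left scaleC_scaleC mult_scaleC_right scaleC_complex_def)

lemma fp_act_resp:
  assumes "nc_prob_space \<phi>" "fp_eq s t"
  shows "fp_act \<phi> s v = fp_act \<phi> t v"
proof -
  have l: "clinear \<phi>" "\<phi> 1 = 1" using assms(1) by (auto simp: nc_prob_space_def)
  show ?thesis
    using assms(2)
    by (induction arbitrary: v rule: fp_eq.induct)
      (simp_all add: fp_act_linear[OF l(1)] clinear_add[OF l(1)] clinear_scaleC[OF l(1)] l(2)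
        algebra_simps scaleC_add_right scaleC_add_left scaleC_scaleC scaleC_one mult_scaleC_left
        mult_scaleC_right scaleC_complex_def plus_idem_alg_def times_idem_alg_def
        scaleC_idem_alg_def one_idem_alg_def)
qed

theorem ex1_ext_functional:
  assumes "nc_prob_space \<phi>"
  shows "\<exists>!\<Phi>. is_ext_functional \<phi> \<Phi>"
proof (rule ex_ex1I)
  have l: "clinear \<phi>" "\<phi> 1 = 1" using assms by (auto simp: nc_prob_space_def)
  define act where "act x = fp_act \<phi> (rep_free_product x)" for x
  have act: "act (abs_free_product t) v = fp_act \<phi> t v" for t v
    unfolding act_def
    by (rule fp_act_resp[OF assms]) (rule rep_abs_rsp_left[OF Quotient3_free_product fp_refl])
  have ex: "\<exists>t. x = abs_free_product t" for x :: "'a ext"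
    by (metis Quotient_abs_rep[OF Quotient_free_product])
  have aadd: "act (x + y) v = act x v + act y v" and amul: "act (x * y) v = act x (act y v)"
    and asc: "act (c *\<^sub>C x) v = c *\<^sub>C act x v" for x y c v
    using ex[of x] ex[of y]
    by (auto simp: act plus_free_product.abs_eq times_free_product.abs_eq
        scaleC_free_product.abs_eq)
  have asc': "act x (c *\<^sub>C v) = c *\<^sub>C act x v" for x c v
    using ex[of x] by (auto simp: act fp_act_linear[OF l(1)])
  have aP: "act projP v = \<phi> v *\<^sub>C 1" for v
    unfolding projP_def by (simp add: inr.abs_eq act)
  have "is_ext_functional \<phi> (\<lambda>x. \<phi> (act x 1))"
    unfolding is_ext_functional_def
    by (auto simp: aadd amul asc asc' aP l clinear_add[OF l(1)] clinear_scaleC[OF l(1)]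
        scaleC_complex_def inl.abs_eq act intro!: clinearI)
  then show "\<exists>\<Phi>. is_ext_functional \<phi> \<Phi>" by (rule exI[of _ "\<lambda>x. \<phi> (act x 1)"])
  fix \<Phi> \<Psi> :: "'a ext \<Rightarrow> complex"
  have key: "\<Xi> (z * x * inl v) = \<Xi> (z * inl (act x v))"
    if "is_ext_functional \<phi> \<Xi>" for \<Xi> z x v
  proof -
    note X = that[unfolded is_ext_functional_def]
    have lin: "clinear \<Xi>" using X by blast
    show ?thesis
    proof (induction x arbitrary: z v rule: free_product_induct)
      case (inl a)
      then show ?case by (simp add: inl.abs_eq act) (simp add: inl.abs_eq[symmetric] inl_mult mult.assoc)
    next
      case (inr b)
      have "(inr b :: 'a ext) = coef1 b *\<^sub>C 1 + coefP b *\<^sub>C projP"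
        using inr_IP[of "coef1 b" "coefP b"] by simp
      then have "\<Xi> (z * inr b * inl v) =
          coef1 b * \<Xi> (z * inl v) + coefP b * \<Xi> (z * projP * inl v)"
        by (simp add: algebra_simps mult_scaleC_left mult_scaleC_right clinear_add[OF lin]
            clinear_scaleC[OF lin] scaleC_complex_def)
      also have "\<Xi> (z * projP * inl v) = \<Xi> z * \<phi> v" using X by metis
      also have "coef1 b * \<Xi> (z * inl v) + coefP b * (\<Xi> z * \<phi> v) = \<Xi> (z * inl (act (inr b) v))"
        by (simp add: inr.abs_eq act)
          (simp add: inl_add inl_scaleC inl_one algebra_simps mult_scaleC_right
            clinear_add[OF lin] clinear_scaleC[OF lin] scaleC_complex_def)
      finally show ?case .
    next
      case (add x y)
      then show ?case
        by (simp add: algebra_simps aadd inl_add clinear_add[OF lin])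
    next
      case (mult x y)
      have "\<Xi> (z * (x * y) * inl v) = \<Xi> ((z * x) * y * inl v)" by (simp add: mult.assoc)
      then show ?case using mult by (simp add: amul)
    next
      case (scaleC c x)
      then show ?case
        by (simp add: mult_scaleC_left mult_scaleC_right asc inl_scaleC clinear_scaleC[OF lin])
    qed
  qed
  assume P: "is_ext_functional \<phi> \<Phi>" and Q: "is_ext_functional \<phi> \<Psi>"
  have "\<Phi> x = \<Psi> x" for x
    using key[OF P, of 1 x 1] key[OF Q, of 1 x 1] P Q
    by (simp add: inl_one is_ext_functional_def)
  then show "\<Phi> = \<Psi>" ..
qed

lemma ext_functional:
  assumes "nc_prob_space \<phi>"
  shows "is_ext_functional \<phi> (ext_functional \<phi>)"
  unfolding ext_functional_def by (rule theI'[OF ex1_ext_functional[OF assms]])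

lemma nc_prob_space_ext_functional:
  assumes "nc_prob_space \<phi>"
  shows "nc_prob_space (ext_functional \<phi>)"
  using ext_functional[OF assms] assms
  unfolding nc_prob_space_def is_ext_functional_def by (metis inl_one)

text \<open>
  Formal linear expressions in symbols \<open>a \<otimes> b\<close> modulo the vector space laws and bilinearity of \<open>\<otimes>\<close>.
\<close>
datatype ('a, 'b) tp_term =
    TTens 'a 'b
  | TAdd "('a, 'b) tp_term" "('a, 'b) tp_term"
  | TScale complex "('a, 'b) tp_term"

inductive tp_eq ::
    "('a::complex_vector, 'b::complex_vector) tp_term \<Rightarrow> ('a, 'b) tp_term \<Rightarrow> bool"
where
  tp_refl: "tp_eq x x"
| tp_sym: "tp_eq x y \<Longrightarrow> tp_eq y x"
| tp_trans: "tp_eq x y \<Longrightarrow> tp_eq y z \<Longrightarrow> tp_eq x z"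
| tp_cong_add: "tp_eq x x' \<Longrightarrow> tp_eq y y' \<Longrightarrow> tp_eq (TAdd x y) (TAdd x' y')"
| tp_cong_scale: "tp_eq x x' \<Longrightarrow> tp_eq (TScale c x) (TScale c x')"
| tp_add_assoc: "tp_eq (TAdd (TAdd x y) z) (TAdd x (TAdd y z))"
| tp_add_comm: "tp_eq (TAdd x y) (TAdd y x)"
| tp_add_zero: "tp_eq (TAdd (TTens 0 0) x) x"
| tp_add_neg: "tp_eq (TAdd (TScale (-1) x) x) (TTens 0 0)"
| tp_scale_add_right: "tp_eq (TScale c (TAdd x y)) (TAdd (TScale c x) (TScale c y))"
| tp_scale_add_left: "tp_eq (TScale (c + d) x) (TAdd (TScale c x) (TScale d x))"
| tp_scale_scale: "tp_eq (TScale c (TScale d x)) (TScale (c * d) x)"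
| tp_scale_one: "tp_eq (TScale 1 x) x"
| tp_tens_add_left: "tp_eq (TTens (a + a') b) (TAdd (TTens a b) (TTens a' b))"
| tp_tens_add_right: "tp_eq (TTens a (b + b')) (TAdd (TTens a b) (TTens a b'))"
| tp_tens_scale_left: "tp_eq (TTens (c *\<^sub>C a) b) (TScale c (TTens a b))"
| tp_tens_scale_right: "tp_eq (TTens a (c *\<^sub>C b)) (TScale c (TTens a b))"

lemmas tp_laws =
  tp_add_assoc tp_add_comm tp_add_zero tp_add_neg tp_scale_add_right
  tp_scale_add_left tp_scale_scale tp_scale_one tp_tens_add_left tp_tens_add_right
  tp_tens_scale_left tp_tens_scale_right

quotient_type (overloaded) ('a, 'b) tensor =
    "('a::complex_vector, 'b::complex_vector) tp_term" / tp_eq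
  by (intro equivpI reflpI sympI transpI) (blast intro: tp_refl tp_sym tp_trans)+

instantiation tensor :: (complex_vector, complex_vector) complex_vector
begin

lift_definition zero_tensor :: "('a, 'b) tensor" is "TTens 0 0" .
lift_definition plus_tensor :: "('a, 'b) tensor \<Rightarrow> ('a, 'b) tensor \<Rightarrow> ('a, 'b) tensor"
  is TAdd by (rule tp_cong_add)
lift_definition scaleC_tensor :: "complex \<Rightarrow> ('a, 'b) tensor \<Rightarrow> ('a, 'b) tensor"
  is TScale by (rule tp_cong_scale)
definition uminus_tensor :: "('a, 'b) tensor \<Rightarrow> ('a, 'b) tensor"
  where "uminus_tensor x = (-1) *\<^sub>C x"
definition minus_tensor :: "('a, 'b) tensor \<Rightarrow> ('a, 'b) tensor \<Rightarrow> ('a, 'b) tensor"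
  where "minus_tensor x y = x + - y"

instance
proof
  fix x y z :: "('a, 'b) tensor" and c d :: complex
  show "x + y + z = x + (y + z)" "x + y = y + x" "0 + x = x"
    "c *\<^sub>C (x + y) = c *\<^sub>C x + c *\<^sub>C y" "(c + d) *\<^sub>C x = c *\<^sub>C x + d *\<^sub>C x"
    "c *\<^sub>C d *\<^sub>C x = (c * d) *\<^sub>C x" "1 *\<^sub>C x = x"
    by (transfer, rule tp_laws)+
  show "- x + x = 0"
    unfolding uminus_tensor_def by (transfer, rule tp_add_neg)
  show "x - y = x + - y" by (rule minus_tensor_def)
qed

end

lift_definition tens :: "'a \<Rightarrow> 'b \<Rightarrow> ('a::complex_vector, 'b::complex_vector) tensor"
  (infixr "\<otimes>" 73) is TTens .

lemma tens_add_left: "(a + a') \<otimes> b = a \<otimes> b + a' \<otimes> b"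
  and tens_add_right: "a \<otimes> (b + b') = a \<otimes> b + a \<otimes> b'"
  and tens_scaleC_left: "(c *\<^sub>C a) \<otimes> b = c *\<^sub>C (a \<otimes> b)"
  and tens_scaleC_right: "a \<otimes> (c *\<^sub>C b) = c *\<^sub>C (a \<otimes> b)"
  by (simp_all only: tens.abs_eq plus_tensor.abs_eq scaleC_tensor.abs_eq tensor.abs_eq_iff tp_laws)

lemma tensor_induct [case_names tens add scaleC]:
  assumes "\<And>a b. P (a \<otimes> b)"
    and "\<And>x y. P x \<Longrightarrow> P y \<Longrightarrow> P (x + y)" "\<And>c x. P x \<Longrightarrow> P (c *\<^sub>C x)"
  shows "P x"
proof -
  have "P (abs_tensor t)" for t
  proof (induction t)
    case (TTens a b) then show ?case using assms(1)[of a b] by (simp add: tens.abs_eq)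
  next
    case (TAdd s t) then show ?case using assms(2) by (simp add: plus_tensor.abs_eq[symmetric])
  next
    case (TScale c t) then show ?case using assms(3) by (simp add: scaleC_tensor.abs_eq[symmetric])
  qed
  then show ?thesis by (metis Quotient_abs_rep[OF Quotient_tensor])
qed

primrec tp_eval :: "('a \<Rightarrow> 'b \<Rightarrow> 'c) \<Rightarrow> ('a, 'b) tp_term \<Rightarrow> 'c::complex_vector" where
  "tp_eval f (TTens a b) = f a b"
| "tp_eval f (TAdd s t) = tp_eval f s + tp_eval f t"
| "tp_eval f (TScale c t) = c *\<^sub>C tp_eval f t"

theorem tensor_universal:
  fixes f :: "'a::complex_vector \<Rightarrow> 'b::complex_vector \<Rightarrow> 'c::complex_vector"
  assumes f1: "\<And>b. clinear (\<lambda>a. f a b)" and f2: "\<And>a. clinear (f a)"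
  shows "\<exists>!h. clinear h \<and> (\<forall>a b. h (a \<otimes> b) = f a b)"
proof (rule ex_ex1I)
  have resp: "tp_eq s t \<Longrightarrow> tp_eval f s = tp_eval f t" for s t
    by (induction rule: tp_eq.induct)
      (simp_all add: algebra_simps clinear_add[OF f1] clinear_add[OF f2] clinear_scaleC[OF f1]
        clinear_scaleC[OF f2] clinear_0[OF f1] clinear_0[OF f2] scaleC_add_right
        scaleC_add_left scaleC_scaleC scaleC_one)
  define h where "h x = tp_eval f (rep_tensor x)" for x
  have h: "h (abs_tensor t) = tp_eval f t" for t
    unfolding h_def by (rule resp) (rule rep_abs_rsp_left[OF Quotient3_tensor tp_refl])
  have ex: "\<exists>t. x = abs_tensor t" for x :: "('a, 'b) tensor"
    by (metis Quotient_abs_rep[OF Quotient_tensor])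
  have hadd: "h (x + y) = h x + h y" and hsc: "h (c *\<^sub>C x) = c *\<^sub>C h x" for x y c
    using ex[of x] ex[of y] by (auto simp: h plus_tensor.abs_eq scaleC_tensor.abs_eq)
  show "\<exists>h. clinear h \<and> (\<forall>a b. h (a \<otimes> b) = f a b)"
    by (intro exI[of _ h]) (auto simp: hadd hsc h tens.abs_eq intro!: clinearI)
next
  fix h h' :: "('a, 'b) tensor \<Rightarrow> 'c"
  assume h: "clinear h \<and> (\<forall>a b. h (a \<otimes> b) = f a b)"
    and h': "clinear h' \<and> (\<forall>a b. h' (a \<otimes> b) = f a b)"
  have "h x = h' x" for x
    by (induction x rule: tensor_induct) (use h h' in \<open>auto simp: clinear_add clinear_scaleC\<close>)
  then show "h = h'" ..
qed

definition tensor_lift ::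
    "('a::complex_vector \<Rightarrow> 'b::complex_vector \<Rightarrow> 'c::complex_vector) \<Rightarrow> ('a, 'b) tensor \<Rightarrow> 'c"
  where "tensor_lift f = (THE h. clinear h \<and> (\<forall>a b. h (a \<otimes> b) = f a b))"

lemma tensor_lift:
  assumes "\<And>b. clinear (\<lambda>a. f a b)" "\<And>a. clinear (f a)"
  shows clinear_tensor_lift: "clinear (tensor_lift f)"
    and tensor_lift_tens: "tensor_lift f (a \<otimes> b) = f a b"
  using theI'[OF tensor_universal[of f, OF assms]] unfolding tensor_lift_def by blast+

definition tens_act :: "'a \<Rightarrow> 'b \<Rightarrow>
    ('a::complex_algebra_1, 'b::complex_algebra_1) tensor \<Rightarrow> ('a, 'b) tensor"
  where "tens_act a b = tensor_lift (\<lambda>c d. (a * c) \<otimes> (b * d))"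

lemma clinear_tens_act: "clinear (tens_act a b)"
  unfolding tens_act_def
  by (intro clinear_tensor_lift clinearI)
    (simp_all add: distrib_left tens_add_left tens_add_right tens_scaleC_left tens_scaleC_right
      mult_scaleC_right)

lemma tens_act_tens: "tens_act a b (c \<otimes> d) = (a * c) \<otimes> (b * d)"
  unfolding tens_act_def
  by (intro tensor_lift_tens clinearI)
    (simp_all add: distrib_left tens_add_left tens_add_right tens_scaleC_left tens_scaleC_right
      mult_scaleC_right)

lemmas tens_act_simps =
  tens_act_tens clinear_add[OF clinear_tens_act] clinear_scaleC[OF clinear_tens_act]

lemma clinear_tens_act_left: "clinear (\<lambda>a. tens_act a b y)"
proof (rule clinearI)
  show "tens_act (a + a') b y = tens_act a b y + tens_act a' b y" for a a'
    by (induction y rule: tensor_induct)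
      (simp_all add: tens_act_simps distrib_right tens_add_left scaleC_add_right add_ac)
  show "tens_act (k *\<^sub>C a) b y = k *\<^sub>C tens_act a b y" for k a
    by (induction y rule: tensor_induct)
      (simp_all add: tens_act_simps mult_scaleC_left tens_scaleC_left scaleC_add_right
        mult.commute)
qed

lemma clinear_tens_act_right: "clinear (\<lambda>b. tens_act a b y)"
proof (rule clinearI)
  show "tens_act a (b + b') y = tens_act a b y + tens_act a b' y" for b b'
    by (induction y rule: tensor_induct)
      (simp_all add: tens_act_simps distrib_right tens_add_right scaleC_add_right add_ac)
  show "tens_act a (k *\<^sub>C b) y = k *\<^sub>C tens_act a b y" for k b
    by (induction y rule: tensor_induct)
      (simp_all add: tens_act_simps mult_scaleC_left tens_scaleC_right scaleC_add_right
        mult.commute)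
qed

text \<open>Multiplication is the bilinear extension of \<open>(a \<otimes> b)(c \<otimes> d) = ac \<otimes> bd\<close>.\<close>
instantiation tensor :: (complex_algebra_1, complex_algebra_1) complex_algebra_1
begin

definition one_tensor :: "('a, 'b) tensor" where "one_tensor = 1 \<otimes> 1"

definition times_tensor :: "('a, 'b) tensor \<Rightarrow> ('a, 'b) tensor \<Rightarrow> ('a, 'b) tensor"
  where "x * y = tensor_lift (\<lambda>a b. tens_act a b y) x"

instance
proof
  have L: "clinear (\<lambda>x. x * y)" for y :: "('a, 'b) tensor"
    unfolding times_tensor_def
    by (intro clinear_tensor_lift clinear_tens_act_left clinear_tens_act_right)
  have T: "(a \<otimes> b) * y = tens_act a b y" for y :: "('a, 'b) tensor" and a b
    unfolding times_tensor_def
    by (intro tensor_lift_tens clinear_tens_act_left clinear_tens_act_right)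
  note S0 = clinear_add[OF L] clinear_scaleC[OF L]
  have R1: "x * (y + z) = x * y + x * z" for x y z :: "('a, 'b) tensor"
    by (induction x rule: tensor_induct)
      (simp_all add: T tens_act_simps S0 scaleC_add_right add_ac)
  have R2: "x * (k *\<^sub>C y) = k *\<^sub>C (x * y)" for x y :: "('a, 'b) tensor" and k
    by (induction x rule: tensor_induct)
      (simp_all add: T tens_act_simps S0 scaleC_add_right mult.commute[of k])
  have TT: "(a \<otimes> b) * (c \<otimes> d) = (a * c) \<otimes> (b * d)" for a c :: 'a and b d :: 'b
    by (simp add: T tens_act_tens)
  note S = R1 R2 S0
  fix x y z :: "('a, 'b) tensor" and k
  show "(x + y) * z = x * z + y * z" "x * (y + z) = x * y + x * z"
    "k *\<^sub>C x * y = k *\<^sub>C (x * y)" "x * k *\<^sub>C y = k *\<^sub>C (x * y)"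
    by (simp_all add: S)
  show "1 * x = x"
    unfolding one_tensor_def by (induction x rule: tensor_induct) (simp_all add: S TT)
  show "x * 1 = x"
    unfolding one_tensor_def by (induction x rule: tensor_induct) (simp_all add: S TT)
  have 1: "(a \<otimes> b) * (c \<otimes> d) * z = (a \<otimes> b) * ((c \<otimes> d) * z)" for a b c d
    by (induction z rule: tensor_induct) (simp_all add: S TT mult.assoc)
  have 2: "(a \<otimes> b) * y * z = (a \<otimes> b) * (y * z)" for a b
    by (induction y rule: tensor_induct) (simp_all add: S 1)
  show "x * y * z = x * (y * z)"
    by (induction x rule: tensor_induct) (simp_all add: S 2)
qed

end

lemma tens_mult_tens:
  fixes a c :: "'a::complex_algebra_1" and b d :: "'b::complex_algebra_1"
  shows "(a \<otimes> b) * (c \<otimes> d) = (a * c) \<otimes> (b * d)"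
proof -
  have "(a \<otimes> b) * (c \<otimes> d) = tens_act a b (c \<otimes> d)"
    unfolding times_tensor_def
    by (intro tensor_lift_tens clinear_tens_act_left clinear_tens_act_right)
  then show ?thesis by (simp add: tens_act_tens)
qed

definition tensor_functional ::
    "('a::complex_vector \<Rightarrow> complex) \<Rightarrow> ('b::complex_vector \<Rightarrow> complex) \<Rightarrow> ('a, 'b) tensor \<Rightarrow> complex"
  where "tensor_functional \<phi>1 \<phi>2 = tensor_lift (\<lambda>a b. \<phi>1 a * \<phi>2 b)"

lemma tensor_functional:
  assumes "clinear \<phi>1" "clinear \<phi>2"
  shows clinear_tensor_functional: "clinear (tensor_functional \<phi>1 \<phi>2)"
    and tensor_functional_tens: "tensor_functional \<phi>1 \<phi>2 (a \<otimes> b) = \<phi>1 a * \<phi>2 b"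
  unfolding tensor_functional_def
  by (intro tensor_lift clinearI;
      simp add: clinear_add[OF assms(1)] clinear_add[OF assms(2)] clinear_scaleC[OF assms(1)]
        clinear_scaleC[OF assms(2)] scaleC_complex_def algebra_simps)+

lemma nc_prob_space_tensor_functional:
  assumes "nc_prob_space \<phi>1" "nc_prob_space \<phi>2"
  shows "nc_prob_space (tensor_functional \<phi>1 \<phi>2)"
  using assms unfolding nc_prob_space_def one_tensor_def
  by (simp add: clinear_tensor_functional tensor_functional_tens)

definition distribution ::
    "('a::complex_algebra_1 \<Rightarrow> complex) \<Rightarrow> 'a \<Rightarrow> complex poly \<Rightarrow> complex"
  where "distribution \<phi> a p = (\<Sum>i\<le>degree p. coeff p i * \<phi> (a ^ i))"

definition delta0 :: "complex poly \<Rightarrow> complex"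
  where "delta0 p = coeff p 0"

lemma distribution_monom: "distribution \<phi> a (monom 1 n) = \<phi> (a ^ n)"
proof -
  have "distribution \<phi> a (monom 1 n) = (\<Sum>i\<le>n. if i = n then \<phi> (a ^ i) else 0)"
    unfolding distribution_def by (intro sum.cong) (simp_all add: degree_monom_eq)
  then show ?thesis by simp
qed

lemma delta0_monom: "delta0 (monom 1 n) = (if n = 0 then 1 else 0)"
  by (simp add: delta0_def)

text \<open>
  Both divisions of power series used with these notions are genuine: \<open>1 + \<psi>\<close> has constant
  coefficient 1, and since \<open>\<eta>\<close> has constant coefficient 0, a composition \<open>\<eta>\<^sub>1 \<circ> \<eta>\<^sub>2\<close> is a multiple of
  \<open>\<eta>\<^sub>2\<close>, so that no negative powers are cut off in a quotient by \<open>\<eta>\<^sub>2 \<noteq> 0\<close>.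
\<close>
definition psi_series :: "('a::complex_algebra_1 \<Rightarrow> complex) \<Rightarrow> 'a \<Rightarrow> complex fps"
  where "psi_series \<phi> a = Abs_fps (\<lambda>n. if n = 0 then 0 else \<phi> (a ^ n))"

definition eta_series :: "('a::complex_algebra_1 \<Rightarrow> complex) \<Rightarrow> 'a \<Rightarrow> complex fps"
  where "eta_series \<phi> a = psi_series \<phi> a / (1 + psi_series \<phi> a)"

end

theory Submission
  imports Defs
begin

text \<open>
  If \<open>\<phi> (x p y) = \<phi> x \<phi> y\<close>, then the coefficients of \<open>\<eta>\<^sub>a\<close> are the Boolean cumulants
  \<open>\<phi> (a (p\<^sup>\<bottom> a)\<^sup>n)\<close>; this applies to the extended algebras with \<open>P\<^sub>1\<close>, \<open>P\<^sub>2\<close> and to their tensor product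
  with \<open>P\<^sub>1 \<otimes> P\<^sub>2\<close>. On vectors, with \<open>\<xi> = \<xi>\<^sub>1 \<otimes> \<xi>\<^sub>2\<close>, \<open>h\<^sub>m = (P\<^sub>1\<^sup>\<bottom> a\<^sub>1)\<^sup>m \<xi>\<^sub>1\<close>, \<open>k\<^sub>n = a\<^sub>2 (P\<^sub>2\<^sup>\<bottom> a\<^sub>2)\<^sup>n \<xi>\<^sub>2\<close> and
  Boolean cumulants \<open>c\<^sub>m\<^sub>+\<^sub>1\<close> of \<open>a\<^sub>1\<close>, \<open>b\<^sub>n\<^sub>+\<^sub>1\<close> of \<open>a\<^sub>2\<close>,
  \<open>Z \<xi> = c\<^sub>1 \<xi> + h\<^sub>1 \<otimes> k\<^sub>0\<close> and
  \<open>Z (h\<^sub>m \<otimes> k\<^sub>n) = h\<^sub>m \<otimes> k\<^sub>n\<^sub>+\<^sub>1 + b\<^sub>n\<^sub>+\<^sub>1 (c\<^sub>m\<^sub>+\<^sub>1 \<xi> + h\<^sub>m\<^sub>+\<^sub>1 \<otimes> k\<^sub>0)\<close> for \<open>m \<ge> 1\<close>.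
  The Boolean cumulants of \<open>Z\<close> count the first returns to \<open>\<xi>\<close>. Besides one initial
  step, an excursion that returns from level \<open>m\<close> passes through \<open>m\<close> levels, each contributing a factor
  \<open>\<Sum>\<^sub>n b\<^sub>n z\<^sup>n = \<eta>\<^bsub>a\<^sub>2\<^esub>(z)\<close>, so \<open>\<eta>\<^sub>Z(z) = z \<Sum>\<^sub>m c\<^sub>m\<^sub>+\<^sub>1 \<eta>\<^bsub>a\<^sub>2\<^esub>(z)\<^sup>m\<close>.
\<close>

section \<open>Power series composition and basic properties of \<eta>\<close>

text \<open>After \<open>N\<close> unrollings the remainder \<open>\<eta> ^ N * g N\<close> has
  order at least \<open>N\<close>, so \<open>N = Suc n\<close> settles coefficient
  \<open>n\<close>.\<close>

lemma fps_compose_unroll: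
  fixes \<eta> :: "'a::comm_ring_1 fps"
  assumes \<eta>: "\<eta> $ 0 = 0" and g: "\<And>m. g m = fps_const (c m) + \<eta> * g (Suc m)"
  shows "g 0 = fps_compose (Abs_fps c) \<eta>"
proof (rule fps_ext)
  fix n
  have unroll: "g 0 = (\<Sum>i<N. fps_const (c i) * \<eta> ^ i) + \<eta> ^ N * g N" for N
  proof (induction N)
    case (Suc N)
    have "\<eta> ^ N * g N = fps_const (c N) * \<eta> ^ N + \<eta> ^ Suc N * g (Suc N)"
      by (subst g) (simp add: algebra_simps)
    then show ?case using Suc by (simp add: add.assoc)
  qed simp
  have "(\<eta> ^ Suc n * g (Suc n)) $ n = 0"
    unfolding fps_mult_nth by (intro sum.neutral ballI) (simp add: startsby_zero_power_prefix[OF \<eta>] del: power_Suc)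
  then have "g 0 $ n = (\<Sum>i<Suc n. c i * \<eta> ^ i $ n)"
    by (subst unroll[of "Suc n"]) (simp add: fps_sum_nth del: power_Suc sum.lessThan_Suc)
  then show "g 0 $ n = (Abs_fps c oo \<eta>) $ n"
    by (simp add: fps_compose_nth atLeast0AtMost lessThan_Suc_atMost del: sum.lessThan_Suc)
qed

lemma psi_series_cong:
  assumes "\<And>n. \<phi> (a ^ n) = \<psi> (b ^ n)"
  shows "psi_series \<phi> a = psi_series \<psi> b"
  by (rule fps_ext) (simp add: psi_series_def assms)

lemma psi_series_nth_0: "psi_series \<phi> a $ 0 = 0"
  by (simp add: psi_series_def)

lemma eta_series_nth_0: "eta_series \<phi> a $ 0 = 0"
  by (simp add: eta_series_def psi_series_nth_0 fps_divide_unit)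

lemma eta_series_eq_0_iff: "eta_series \<phi> a = 0 \<longleftrightarrow> psi_series \<phi> a = 0"
proof -
  have "eta_series \<phi> a * (1 + psi_series \<phi> a) = psi_series \<phi> a"
    unfolding eta_series_def
    by (simp add: psi_series_nth_0 fps_divide_unit mult.assoc inverse_mult_eq_1)
  then show ?thesis by (auto simp: eta_series_def)
qed

text \<open>Turns the case distinction of the theorem into whether one can divide by \<eta>.\<close>

lemma distribution_eq_delta0_iff:
  assumes "nc_prob_space \<phi>"
  shows "distribution \<phi> a = delta0 \<longleftrightarrow> eta_series \<phi> a = 0"
proof -
  have "distribution \<phi> a = delta0 \<longleftrightarrow> (\<forall>n>0. \<phi> (a ^ n) = 0)"
  proof
    assume "distribution \<phi> a = delta0"
    then show "\<forall>n>0. \<phi> (a ^ n) = 0"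
      by (metis distribution_monom delta0_monom less_not_refl)
  next
    assume 0: "\<forall>n>0. \<phi> (a ^ n) = 0"
    have "coeff p i * \<phi> (a ^ i) = (if i = 0 then coeff p 0 else 0)" for p i
      using 0 assms by (simp add: nc_prob_space_def)
    then show "distribution \<phi> a = delta0"
      by (simp add: fun_eq_iff distribution_def delta0_def)
  qed
  also have "\<dots> \<longleftrightarrow> psi_series \<phi> a = 0"
    by (auto simp: psi_series_def fps_eq_iff)
  finally show ?thesis by (simp add: eta_series_eq_0_iff)
qed

section \<open>Boolean cumulants of a vector state\<close>

text \<open>Abstracts the vector state of \<open>\<xi>\<close> together with the projection \<open>p\<close> onto \<open>\<complex>\<xi>\<close>.\<close>
locale vector_state =
  fixes \<phi> :: "'a::complex_algebra_1 \<Rightarrow> complex" and p :: 'a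
  assumes nc: "nc_prob_space \<phi>" and idem: "p * p = p"
    and state: "\<phi> (x * p * y) = \<phi> x * \<phi> y"
begin

lemma linear: "clinear \<phi>" and unit: "\<phi> 1 = 1"
  using nc by (auto simp: nc_prob_space_def)

lemmas diff = clinear_diff[OF linear] and zero = clinear_0[OF linear]

definition cumulant :: "'a \<Rightarrow> nat \<Rightarrow> complex"
  where "cumulant a n = \<phi> (a * ((1 - p) * a) ^ n)"

lemma state_right: "\<phi> (x * p) = \<phi> x"
  using state[of x 1] by (simp add: unit)

text \<open>The exponent must be positive: \<open>1 - p\<close> does not fix the power
  \<open>1\<close>.\<close>

lemma proj_perp_power: "(1 - p) * ((1 - p) * a) ^ Suc n = ((1 - p) * a) ^ Suc n"
proof -
  have "(1 - p) * (1 - p) = 1 - p"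
    by (simp add: left_diff_distrib right_diff_distrib idem)
  then show ?thesis by (simp add: mult.assoc[symmetric])
qed

lemma proj_power: "p * ((1 - p) * a) ^ Suc n = 0"
  using proj_perp_power[of a n] by (simp add: left_diff_distrib)

text \<open>Insert \<open>1 = p + (1 - p)\<close> after successive factors \<open>a\<close>: the
  first \<open>p\<close> splits the moment by \<open>state\<close>, while each \<open>1 - p\<close>
  lengthens the cumulant.\<close>

lemma moment_cumulant: "\<phi> (a ^ Suc n) = (\<Sum>k\<le>n. cumulant a k * \<phi> (a ^ (n - k)))"
proof -
  let ?b = "(1 - p) * a"
  have *: "\<phi> (a ^ Suc n) = (\<Sum>k<j. cumulant a k * \<phi> (a ^ (n - k))) + \<phi> (a * ?b ^ j * a ^ (n - j))"
    if "j \<le> n" for j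
    using that
  proof (induction j)
    case (Suc j)
    then have n: "n - j = Suc (n - Suc j)" by simp
    have "a * u * (a * v) - a * (u * ?b) * v = a * u * p * (a * v)" for u v
      by (simp add: left_diff_distrib right_diff_distrib mult.assoc)
    from this[of "?b ^ j" "a ^ (n - Suc j)"]
    have "\<phi> (a * ?b ^ j * a ^ (n - j)) - \<phi> (a * ?b ^ Suc j * a ^ (n - Suc j)) =
        cumulant a j * \<phi> (a ^ (n - j))"
      by (simp only: n power_Suc[of a] power_Suc2[of ?b] diff[symmetric] state cumulant_def)
    then show ?case using Suc by (simp add: diff_eq_eq del: power_Suc)
  qed simp
  show ?thesis
    using *[of n] by (simp add: cumulant_def unit flip: lessThan_Suc_atMost)
qed

text \<open>The factor \<open>fps_X\<close> shifts the index, since \<open>cumulant a n\<close> is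
  the Boolean cumulant of order \<open>n + 1\<close>.\<close>

lemma eta_series_cumulant: "eta_series \<phi> a = fps_X * Abs_fps (cumulant a)"
proof -
  let ?\<psi> = "psi_series \<phi> a"
  have "fps_X * Abs_fps (cumulant a) * (1 + ?\<psi>) = ?\<psi>"
  proof (rule fps_ext)
    fix n
    have \<psi>: "(1 + ?\<psi>) $ k = \<phi> (a ^ k)" for k
      by (simp add: psi_series_def unit)
    show "(fps_X * Abs_fps (cumulant a) * (1 + ?\<psi>)) $ n = ?\<psi> $ n"
    proof (cases n)
      case (Suc m)
      have "(fps_X * Abs_fps (cumulant a) * (1 + ?\<psi>)) $ n = (Abs_fps (cumulant a) * (1 + ?\<psi>)) $ m"
        unfolding Suc mult.assoc by simp
      also have "\<dots> = \<phi> (a ^ Suc m)"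
        unfolding moment_cumulant fps_mult_nth \<psi> by (simp add: atLeast0AtMost)
      finally show ?thesis by (simp add: psi_series_def Suc)
    qed (simp add: psi_series_def)
  qed
  moreover have "1 + ?\<psi> \<noteq> 0"
    by (metis fps_add_nth fps_one_nth fps_zero_nth psi_series_nth_0 add.right_neutral zero_neq_one)
  ultimately show ?thesis
    unfolding eta_series_def by (metis nonzero_mult_div_cancel_right)
qed

end

lemma vector_state_ext_functional:
  assumes "nc_prob_space \<phi>"
  shows "vector_state (ext_functional \<phi>) projP"
  using ext_functional[OF assms] nc_prob_space_ext_functional[OF assms]
  by (simp add: vector_state_def is_ext_functional_def projP_idem)

lemma inl_power: "inl (a ^ n) = inl a ^ n"
  by (induction n) (simp_all add: inl_one inl_mult)

lemma eta_series_ext_functional: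
  assumes "nc_prob_space \<phi>"
  shows "eta_series (ext_functional \<phi>) (inl a) = eta_series \<phi> a"
proof -
  have "psi_series (ext_functional \<phi>) (inl a) = psi_series \<phi> a"
    using ext_functional[OF assms]
    by (intro psi_series_cong) (simp add: is_ext_functional_def flip: inl_power)
  then show ?thesis by (simp add: eta_series_def)
qed

section \<open>Tensor product of two vector states\<close>

lemma tens_diff_left: "(a - a') \<otimes> b = a \<otimes> b - a' \<otimes> b"
  using tens_add_left[of "a - a'" a' b] by simp

lemma tens_zero_left: "0 \<otimes> b = 0"
  using tens_diff_left[of 0 0 b] by simp

locale vector_state_pair =
  s1: vector_state \<phi>1 p1 + s2: vector_state \<phi>2 p2
  for \<phi>1 :: "'a::complex_algebra_1 \<Rightarrow> complex" and p1
    and \<phi>2 :: "'b::complex_algebra_1 \<Rightarrow> complex" and p2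
begin

abbreviation \<phi> :: "('a, 'b) tensor \<Rightarrow> complex"
  where "\<phi> \<equiv> tensor_functional \<phi>1 \<phi>2"

lemma functional_tens: "\<phi> (x \<otimes> y) = \<phi>1 x * \<phi>2 y"
  by (rule tensor_functional_tens[OF s1.linear s2.linear])

lemma nc_prob_space: "nc_prob_space \<phi>"
  by (rule nc_prob_space_tensor_functional[OF s1.nc s2.nc])

lemma add: "\<phi> (x + y) = \<phi> x + \<phi> y" and scaleC: "\<phi> (c *\<^sub>C x) = c * \<phi> x"
  using nc_prob_space
  by (simp_all add: nc_prob_space_def clinear_add clinear_scaleC scaleC_complex_def)

text \<open>The values \<open>\<phi> (w * v)\<close> for arbitrary \<open>w\<close> stand for the
  vector \<open>v \<xi>\<close>; in this form \<open>p1\<close> sends \<open>x \<xi>\<^sub>1\<close>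
  to \<open>\<phi>1 x\<close> times \<open>\<xi>\<^sub>1\<close>.\<close>

lemma proj_left: "\<phi> (w * ((p1 * x) \<otimes> y)) = \<phi>1 x * \<phi> (w * (1 \<otimes> y))"
proof (induction w rule: tensor_induct)
  case (tens a b)
  then show ?case by (simp add: tens_mult_tens functional_tens s1.state flip: mult.assoc)
qed (simp_all add: distrib_right add scaleC mult_scaleC_left algebra_simps)

lemma proj_right: "\<phi> (w * (x \<otimes> (y * p2 * v))) = \<phi>2 v * \<phi> (w * (x \<otimes> y))"
proof (induction w rule: tensor_induct)
  case (tens a b)
  then show ?case by (simp add: tens_mult_tens functional_tens s2.state flip: mult.assoc)
qed (simp_all add: distrib_right add scaleC mult_scaleC_left algebra_simps)

lemma proj_both: "\<phi> (w * ((p1 * x) \<otimes> (p2 * y))) = \<phi>1 x * \<phi>2 y * \<phi> w"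
  using proj_left[of w x "p2 * y"] proj_right[of w 1 1 y]
  by (simp flip: one_tensor_def)

text \<open>\<open>p2\<close> fixes \<open>\<xi>\<^sub>2\<close>, so \<open>1 - p2\<close> kills
  it.\<close>

lemma perp_right: "\<phi> (w * (x \<otimes> (y * (1 - p2)))) = 0"
proof (induction w rule: tensor_induct)
  case (tens a b)
  have "\<phi>2 (b * (y * (1 - p2))) = 0"
    using s2.state_right[of "b * y"] by (simp add: right_diff_distrib s2.diff mult.assoc)
  then show ?case by (simp add: tens_mult_tens functional_tens)
qed (simp_all add: distrib_right add scaleC mult_scaleC_left)

sublocale prod: vector_state \<phi> "p1 \<otimes> p2"
proof (rule vector_state.intro[OF nc_prob_space])
  show "(p1 \<otimes> p2) * (p1 \<otimes> p2) = p1 \<otimes> p2"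
    by (simp add: tens_mult_tens s1.idem s2.idem)
  fix w y
  show "\<phi> (w * (p1 \<otimes> p2) * y) = \<phi> w * \<phi> y"
  proof (induction y rule: tensor_induct)
    case (tens a b)
    show ?case by (simp add: mult.assoc tens_mult_tens proj_both functional_tens)
  qed (simp_all add: distrib_left add scaleC mult_scaleC_right algebra_simps)
qed

section \<open>First returns of \<open>Z\<close> to \<xi>\<close>

context
  fixes a1 :: 'a and a2 :: 'b
begin

definition Z :: "('a, 'b) tensor"
  where "Z = ((1 - p1) \<otimes> a2 + p1 \<otimes> 1) * (a1 \<otimes> p2 + 1 \<otimes> (1 - p2))"

abbreviation "Q \<equiv> 1 - p1 \<otimes> p2"
abbreviation "h m \<equiv> ((1 - p1) * a1) ^ m"
abbreviation "k n \<equiv> a2 * ((1 - p2) * a2) ^ n"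

lemma Z_tens:
  "Z * (x \<otimes> y) = ((1 - p1) * a1 * x) \<otimes> (a2 * p2 * y) + (p1 * (a1 * x)) \<otimes> (p2 * y)
    + ((1 - p1) * x) \<otimes> (a2 * ((1 - p2) * y)) + (p1 * x) \<otimes> ((1 - p2) * y)"
  by (simp add: Z_def distrib_left distrib_right tens_mult_tens mult.assoc add_ac)

lemma Z_unit: "\<phi> (w * Z) = s1.cumulant a1 0 * \<phi> w + \<phi> (w * (h 1 \<otimes> k 0))"
proof -
  have "\<phi> (w * Z) = \<phi> (w * (Z * (1 \<otimes> 1)))"
    by (simp flip: one_tensor_def)
  also have "\<dots> = \<phi> (w * (h 1 \<otimes> k 0)) + s1.cumulant a1 0 * \<phi> w"
    unfolding Z_tens distrib_left add
    using proj_right[of w "h 1" "a2" 1] proj_both[of w a1 1]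
      perp_right[of w "1 - p1" a2] perp_right[of w p1 1]
    by (simp add: s1.cumulant_def s2.unit)
  finally show ?thesis by simp
qed

text \<open>\<open>p1\<close> kills \<open>h (Suc m)\<close>, so the last summand of
  \<open>Z_tens\<close> vanishes; each \<open>p2\<close> splits off a cumulant of
  \<open>a2\<close>.\<close>

lemma Z_step:
  "\<phi> (w * (Z * (h (Suc m) \<otimes> k n))) = \<phi> (w * (h (Suc m) \<otimes> k (Suc n)))
    + s2.cumulant a2 n * (s1.cumulant a1 (Suc m) * \<phi> w + \<phi> (w * (h (Suc (Suc m)) \<otimes> k 0)))"
proof -
  have "Z * (h (Suc m) \<otimes> k n) = h (Suc (Suc m)) \<otimes> (a2 * p2 * k n)
      + (p1 * (a1 * h (Suc m))) \<otimes> (p2 * k n) + h (Suc m) \<otimes> k (Suc n)"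
    unfolding Z_tens s1.proj_perp_power s1.proj_power tens_zero_left
    by (simp add: mult.assoc)
  then show ?thesis
    unfolding distrib_left add
    using proj_right[of w "h (Suc (Suc m))" "a2" "k n"] proj_both[of w "a1 * h (Suc m)" "k n"]
    by (simp add: s1.cumulant_def s2.cumulant_def distrib_left add mult.assoc add_ac)
qed

text \<open>\<open>Q\<close> removes the component along \<xi> before each step, so this is the
  total weight of first arrivals at \<xi> after exactly \<open>j\<close> steps.\<close>

definition excursion :: "nat \<Rightarrow> nat \<Rightarrow> nat \<Rightarrow> complex"
  where "excursion m n j = \<phi> ((Z * Q) ^ j * (h (Suc m) \<otimes> k n))"

lemma first_return_unit: "\<phi> ((Z * Q) ^ j) = (if j = 0 then 1 else 0)"
proof (cases j)
  case (Suc i)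
  have "\<phi> (w * Q) = 0" for w
    using prod.state_right[of w] by (simp add: right_diff_distrib prod.diff)
  from this[of "(Z * Q) ^ i * Z"] show ?thesis
    by (simp only: Suc power_Suc2 mult.assoc) simp
qed (simp add: prod.unit)

lemma Q_tens: "Q * (h (Suc m) \<otimes> y) = h (Suc m) \<otimes> y"
  unfolding left_diff_distrib[of 1 "p1 \<otimes> p2"] tens_mult_tens s1.proj_power by (simp add: tens_zero_left)

lemma excursion_0: "excursion m n 0 = 0"
proof -
  have "\<phi>1 (h (Suc m)) = 0"
    using s1.state[of 1 "h (Suc m)"] unfolding mult_1_left s1.proj_power
    by (simp add: s1.zero s1.unit)
  then show ?thesis by (simp only: excursion_def power_0 mult_1_left functional_tens mult_zero_left)
qed

lemma excursion_Suc:
  "excursion m n (Suc j) = excursion m (Suc n) j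
    + s2.cumulant a2 n * ((if j = 0 then s1.cumulant a1 (Suc m) else 0) + excursion (Suc m) 0 j)"
proof -
  have "excursion m n (Suc j) = \<phi> ((Z * Q) ^ j * (Z * (h (Suc m) \<otimes> k n)))"
    unfolding excursion_def power_Suc2[of "Z * Q"] mult.assoc Q_tens ..
  then show ?thesis
    unfolding Z_step first_return_unit excursion_def[symmetric] by simp
qed

text \<open>\<open>i\<close> counts the steps within the level before it is left, either to \<xi>
  with no steps remaining or to the next level.\<close>

lemma excursion_level:
  "excursion m n j = (\<Sum>i<j. s2.cumulant a2 (n + i) *
    ((if j - Suc i = 0 then s1.cumulant a1 (Suc m) else 0) + excursion (Suc m) 0 (j - Suc i)))"
proof (induction j arbitrary: n)
  case (Suc j)
  show ?case
    unfolding sum.lessThan_Suc_shift excursion_Suc Suc[of "Suc n"] by simp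
qed (simp add: excursion_0)

lemma cumulant_Z:
  "prod.cumulant Z j = (if j = 0 then s1.cumulant a1 0 else 0) + excursion 0 0 j"
proof -
  \<comment> \<open>Rebracketing lets the last \<open>Z\<close> act on \<xi> first, as
    \<open>Z_unit\<close> requires.\<close>
  have "Z * (Q * Z) ^ j = (Z * Q) ^ j * Z"
  proof (induction j)
    case (Suc j)
    have "Z * (Q * Z) ^ Suc j = Z * (Q * Z) ^ j * (Q * Z)"
      by (simp only: power_Suc2 mult.assoc)
    also have "\<dots> = (Z * Q) ^ Suc j * Z"
      by (simp only: Suc power_Suc2 mult.assoc)
    finally show ?case .
  qed (simp only: power_0 mult_1_left mult_1_right)
  then have "prod.cumulant Z j = \<phi> ((Z * Q) ^ j * Z)"
    by (simp only: prod.cumulant_def)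
  then show ?thesis
    unfolding Z_unit first_return_unit excursion_def by simp
qed

theorem eta_series_Z:
  "eta_series \<phi> Z = fps_X * fps_compose (Abs_fps (s1.cumulant a1)) (eta_series \<phi>2 a2)"
proof -
  \<comment> \<open>Generating function over the steps remaining once level \<open>m\<close> has
    been left: return at once, or pass through the next level.\<close>
  define g where "g m = fps_const (s1.cumulant a1 m) + Abs_fps (excursion m 0)" for m
  have g_nth: "g m $ j = (if j = 0 then s1.cumulant a1 m else 0) + excursion m 0 j" for m j
    by (simp add: g_def)
  have level: "Abs_fps (excursion m 0) = eta_series \<phi>2 a2 * g (Suc m)" for m
  proof (rule fps_ext)
    fix j
    show "Abs_fps (excursion m 0) $ j = (eta_series \<phi>2 a2 * g (Suc m)) $ j"
    proof (cases j)
      case (Suc i)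
      have "(eta_series \<phi>2 a2 * g (Suc m)) $ j = (Abs_fps (s2.cumulant a2) * g (Suc m)) $ i"
        unfolding s2.eta_series_cumulant mult.assoc Suc by simp
      also have "\<dots> = excursion m 0 (Suc i)"
        by (subst excursion_level) (simp add: fps_mult_nth g_nth atLeast0AtMost lessThan_Suc_atMost)
      finally show ?thesis by (simp add: Suc)
    qed (simp add: excursion_0 eta_series_nth_0)
  qed
  have "g m = fps_const (s1.cumulant a1 m) + eta_series \<phi>2 a2 * g (Suc m)" for m
    unfolding level[symmetric] by (rule g_def)
  then have "g 0 = fps_compose (Abs_fps (s1.cumulant a1)) (eta_series \<phi>2 a2)"
    by (rule fps_compose_unroll[OF eta_series_nth_0])
  moreover have "Abs_fps (prod.cumulant Z) = g 0"
    by (rule fps_ext) (simp add: g_nth cumulant_Z)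
  ultimately show ?thesis by (simp add: prod.eta_series_cumulant)
qed

end

end

theorem theorem4p1:
  fixes \<phi>1 :: "'a::complex_algebra_1 \<Rightarrow> complex" and \<phi>2 :: "'b::complex_algebra_1 \<Rightarrow> complex"
    and a1 :: 'a and a2 :: 'b
    and \<phi> :: "('a ext, 'b ext) tensor \<Rightarrow> complex"
    and R1 R2 Z :: "('a ext, 'b ext) tensor"
  assumes "nc_prob_space \<phi>1" and "nc_prob_space \<phi>2"
    and "\<phi> = tensor_functional (ext_functional \<phi>1) (ext_functional \<phi>2)"
    and "R1 = inl a1 \<otimes> projP + 1 \<otimes> projP_perp"
    and "R2 = projP_perp \<otimes> inl a2 + projP \<otimes> 1"
    and "Z = R2 * R1"
  shows "(distribution \<phi>2 a2 \<noteq> delta0 \<longrightarrow>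
            eta_series \<phi> Z =
              fps_X * fps_compose (eta_series \<phi>1 a1) (eta_series \<phi>2 a2) / eta_series \<phi>2 a2) \<and>
         (distribution \<phi>2 a2 = delta0 \<longrightarrow>
            eta_series \<phi> Z = fps_X * fps_const (distribution \<phi>1 a1 [:0, 1:]))"
proof -
  interpret vector_state_pair "ext_functional \<phi>1" projP "ext_functional \<phi>2" projP
    using assms(1,2) by (intro vector_state_pair.intro vector_state_ext_functional)
  let ?\<eta>2 = "eta_series \<phi>2 a2" and ?c = "Abs_fps (s1.cumulant (inl a1))"
  have Z: "eta_series \<phi> Z = fps_X * fps_compose ?c ?\<eta>2"
    using eta_series_Z[of "inl a1" "inl a2", unfolded Z_def] assms
    by (simp add: projP_perp_def eta_series_ext_functional)
  have "eta_series \<phi>1 a1 = fps_X * ?c"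
    using s1.eta_series_cumulant[of "inl a1"] assms(1) by (simp add: eta_series_ext_functional)
  then have comp: "fps_compose (eta_series \<phi>1 a1) ?\<eta>2 = ?\<eta>2 * fps_compose ?c ?\<eta>2"
    by (simp add: fps_compose_mult_distrib eta_series_nth_0)
  have "eta_series \<phi> Z = fps_X * fps_compose (eta_series \<phi>1 a1) ?\<eta>2 / ?\<eta>2"
    if "?\<eta>2 \<noteq> 0"
    using that unfolding Z comp by (simp add: mult.left_commute)
  moreover have "?c $ 0 = distribution \<phi>1 a1 [:0, 1:]"
    using ext_functional[OF assms(1)]
    by (simp add: s1.cumulant_def distribution_def is_ext_functional_def)
  \<comment> \<open>If \<open>?\<eta>2 = 0\<close>, the composition in \<open>Z\<close> reduces to
    the constant coefficient of \<open>?c\<close>.\<close>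
  ultimately show ?thesis
    using Z by (simp add: distribution_eq_delta0_iff[OF assms(2)])
qed

end
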